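(* Let $n\geqslant 3$, let $M \in \{\mathcal{ODI}_n, \mathcal{MDI}_n, \mathcal{OPDI}_n\}$ and let $\alpha, \beta \in M$. Then $\alpha \mathrel{\mathscr{J}} \beta$ in $M$ if and only if one of the following properties is satisfied: 1. $|\mathrm{Dom}(\alpha)| = |\mathrm{Dom}(\beta)| \leqslant 1$; 2. $|\mathrm{Dom}(\alpha)| = |\mathrm{Dom}(\beta)| \geqslant 2$ and - if $M=\mathcal{ODI}_n$: $\mathrm{d}(\mathrm{Dom}(\alpha)) = \mathrm{d}(\mathrm{Dom}(\beta))$; - if $M=\mathcal{MDI}_n$: $\mathrm{d}(\mathrm{Dom}(\alpha)) = \mathrm{d}(\mathrm{Dom}(\beta))$ or $\mathrm{d}(\mathrm{Dom}(\alpha)) = \mathrm{d}(\mathrm{Dom}(h\beta))$; - if $M=\mathcal{OPDI}_n$: $\mathrm{d}(\mathrm{Dom}(\alpha)) = \mathrm{d}(\mathrm{Dom}(g^s\beta))$ for some $0\leqslant s\leqslant n-1$.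
   Context: Let $\Omega_n=\{1<2<\cdots<n\}$. A partial transformation of $\Omega_n$ is a map $\alpha$ from a subset $\mathrm{Dom}(\alpha)\subseteq\Omega_n$ (possibly empty) to $\Omega_n$; maps are written on the right and composed left to right: $x(\alpha\beta)=(x\alpha)\beta$ with $\mathrm{Dom}(\alpha\beta)=\{x\in\mathrm{Dom}(\alpha)\mid x\alpha\in\mathrm{Dom}(\beta)\}$. The cycle graph $C_n$ has vertex set $\Omega_n$ and edges $\{i,i+1\}$ ($1\leqslant i\leqslant n-1$) and $\{1,n\}$; its geodesic distance is $\mathrm{d}(x,y)=\min\{|x-y|,n-|x-y|\}$. A partial isometry of $C_n$ is a partial transformation $\alpha$ of $\Omega_n$ with $\mathrm{d}(x\alpha,y\alpha)=\mathrm{d}(x,y)$ for all $x,y\in\mathrm{Dom}(\alpha)$ (such $\alpha$ is necessarily injective). $\mathcal{DI}_n$ is the monoid of all partial isometries of $C_n$ under composition. A partial transformation $\alpha$ is order-preserving [order-reversing] if $x\leqslant y$ implies $x\alpha\leqslant y\alpha$ [$x\alpha\geqslant y\alpha$] for all $x,y\in\mathrm{Dom}(\alpha)$; it is monotone if it is order-preserving or order-reversing. A sequence $(a_1,\ldots,a_t)$ ($t\geqslant 0$) of elements of $\Omega_n$ is cyclic if there is at most one index $i\in\{1,\ldots,t\}$ with $a_i>a_{i+1}$, where $a_{t+1}=a_1$. A partial transformation $\alpha$ with $\mathrm{Dom}(\alpha)=\{a_1<\cdots<a_t\}$ is orientation-preserving if $(a_1\alpha,\ldots,a_t\alpha)$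 is cyclic. $\mathcal{ODI}_n$, $\mathcal{MDI}_n$, $\mathcal{OPDI}_n$ are the submonoids of $\mathcal{DI}_n$ of all order-preserving, monotone, and orientation-preserving elements, respectively. Green's relation $\mathscr{J}$ on a monoid $M$: $a\mathrel{\mathscr{J}}b$ iff $MaM=MbM$. $g$ and $h$ are the permutations of $\Omega_n$ given by $ig=i+1$ for $1\leqslant i\leqslant n-1$, $ng=1$, and $ih=n-i+1$ for $1\leqslant i\leqslant n$. For $A=\{i_1<i_2<\cdots<i_k\}\subseteq\Omega_n$ with $2\leqslant k\leqslant n$, $\mathrm{d}(A)$ denotes the $k$-tuple $(d_1,\ldots,d_k)$ with $d_p=\mathrm{d}(i_p,i_{p+1})$ for $1\leqslant p\leqslant k-1$ and $d_k=\mathrm{d}(i_1,i_k)$. *)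

theory Defs
  imports "HOL-Algebra.Group"
begin

text \<open>
  Partial transformations of \<open>{1..n}\<close> are represented by partial maps \<open>nat \<rightharpoonup> nat\<close>.
  Since the source writes maps on the right and composes from left to right, the product
  \<open>\<alpha> \<beta>\<close> is \<open>\<beta> \<circ>\<^sub>m \<alpha>\<close>, which applies \<open>\<alpha>\<close> first.
\<close>

definition Omega :: "nat \<Rightarrow> nat set"
  where "Omega n = {1..n}"

definition partial_transformations :: "nat \<Rightarrow> (nat \<rightharpoonup> nat) set"
  where "partial_transformations n = {\<alpha>. dom \<alpha> \<subseteq> Omega n \<and> ran \<alpha> \<subseteq> Omega n}"

definition cycle_edges :: "nat \<Rightarrow> (nat \<times> nat) set"
  where "cycle_edges n =
    {(i, j). i \<in> Omega n \<and> j \<in> Omega n \<and> (j = i + 1 \<or> i = j + 1 \<or> {i, j} = {1, n})}"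

text \<open>
  The geodesic distance of the cycle graph, given by its closed form. It is integer-valued only to
  avoid truncated subtraction; the lemma \<open>cycle_dist_geodesic\<close> below shows that it is the length
  of a shortest walk.
\<close>

definition cycle_dist :: "nat \<Rightarrow> nat \<Rightarrow> nat \<Rightarrow> int"
  where "cycle_dist n x y = min \<bar>int x - int y\<bar> (int n - \<bar>int x - int y\<bar>)"

definition partial_isometries :: "nat \<Rightarrow> (nat \<rightharpoonup> nat) set"
  where "partial_isometries n =
    {\<alpha> \<in> partial_transformations n. \<forall>x\<in>dom \<alpha>. \<forall>y\<in>dom \<alpha>.
      cycle_dist n (the (\<alpha> x)) (the (\<alpha> y)) = cycle_dist n x y}"

definition DI :: "nat \<Rightarrow> (nat \<rightharpoonup> nat) monoid"
  where "DI n =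
    \<lparr>carrier = partial_isometries n,
     mult = (\<lambda>\<alpha> \<beta>. \<beta> \<circ>\<^sub>m \<alpha>),
     one = (\<lambda>x. if x \<in> Omega n then Some x else None)\<rparr>"

definition order_preserving :: "(nat \<rightharpoonup> nat) \<Rightarrow> bool"
  where "order_preserving \<alpha> \<longleftrightarrow> mono_on (dom \<alpha>) (\<lambda>x. the (\<alpha> x))"

definition order_reversing :: "(nat \<rightharpoonup> nat) \<Rightarrow> bool"
  where "order_reversing \<alpha> \<longleftrightarrow> antimono_on (dom \<alpha>) (\<lambda>x. the (\<alpha> x))"

text \<open>The list is indexed from \<open>0\<close>; the index modulo the length closes the sequence up.\<close>

definition cyclic :: "nat list \<Rightarrow> bool"
  where "cyclic as \<longleftrightarrow>
    card {i. i < length as \<and> as ! i > as ! ((i + 1) mod length as)} \<le> 1"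

definition orientation_preserving :: "(nat \<rightharpoonup> nat) \<Rightarrow> bool"
  where "orientation_preserving \<alpha> \<longleftrightarrow>
    cyclic (map (\<lambda>x. the (\<alpha> x)) (sorted_list_of_set (dom \<alpha>)))"

definition ODI :: "nat \<Rightarrow> (nat \<rightharpoonup> nat) monoid"
  where "ODI n = (DI n)\<lparr>carrier := {\<alpha> \<in> carrier (DI n). order_preserving \<alpha>}\<rparr>"

definition MDI :: "nat \<Rightarrow> (nat \<rightharpoonup> nat) monoid"
  where "MDI n =
    (DI n)\<lparr>carrier := {\<alpha> \<in> carrier (DI n). order_preserving \<alpha> \<or> order_reversing \<alpha>}\<rparr>"

definition OPDI :: "nat \<Rightarrow> (nat \<rightharpoonup> nat) monoid"
  where "OPDI n = (DI n)\<lparr>carrier := {\<alpha> \<in> carrier (DI n). orientation_preserving \<alpha>}\<rparr>"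

definition two_sided_ideal :: "('a, 'b) monoid_scheme \<Rightarrow> 'a \<Rightarrow> 'a set"
  where "two_sided_ideal M a =
    {x \<otimes>\<^bsub>M\<^esub> a \<otimes>\<^bsub>M\<^esub> y | x y. x \<in> carrier M \<and> y \<in> carrier M}"

definition Green_J :: "('a, 'b) monoid_scheme \<Rightarrow> 'a \<Rightarrow> 'a \<Rightarrow> bool"
  where "Green_J M a b \<longleftrightarrow> two_sided_ideal M a = two_sided_ideal M b"

definition rotation :: "nat \<Rightarrow> nat \<rightharpoonup> nat"
  where "rotation n i =
    (if 1 \<le> i \<and> i \<le> n - 1 then Some (i + 1) else if i = n then Some 1 else None)"

definition reflection :: "nat \<Rightarrow> nat \<rightharpoonup> nat"
  where "reflection n i = (if i \<in> Omega n then Some (n - i + 1) else None)"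

text \<open>
  For \<open>A = {i\<^sub>1 < \<dots> < i\<^sub>k}\<close> this is \<open>(d(i\<^sub>1,i\<^sub>2), \<dots>, d(i\<^sub>k\<^sub>-\<^sub>1,i\<^sub>k), d(i\<^sub>1,i\<^sub>k))\<close>. It is meaningful
  only for \<open>2 \<le> card A\<close>.
\<close>

definition dist_tuple :: "nat \<Rightarrow> nat set \<Rightarrow> int list"
  where "dist_tuple n A =
    (let is = sorted_list_of_set A; k = length is
     in map (\<lambda>p. cycle_dist n (is ! p) (is ! (p + 1))) [0..<k - 1]
        @ [cycle_dist n (is ! 0) (is ! (k - 1))])"

lemma cycle_dist_edge:
  assumes "n \<ge> 3" "(y, z) \<in> cycle_edges n" "x \<in> Omega n"
  shows "cycle_dist n x z \<le> cycle_dist n x y + 1"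
  using assms unfolding cycle_dist_def cycle_edges_def Omega_def
  by (auto simp: doubleton_eq_iff)

lemma cycle_dist_le_walk:
  assumes "n \<ge> 3" "x \<in> Omega n" "(x, y) \<in> cycle_edges n ^^ k"
  shows "cycle_dist n x y \<le> int k"
  using assms(3)
proof (induction k arbitrary: y)
  case 0
  then show ?case using assms(1) by (simp add: cycle_dist_def)
next
  case (Suc k)
  then obtain z where "(x, z) \<in> cycle_edges n ^^ k" "(z, y) \<in> cycle_edges n"
    by auto
  then show ?case
    using Suc.IH[of z] cycle_dist_edge[OF assms(1) _ assms(2), of z y] by simp
qed

lemma cycle_walk_up:
  assumes "1 \<le> x" "x + k \<le> n"
  shows "(x, x + k) \<in> cycle_edges n ^^ k"
  using assms(2)
proof (induction k)
  case (Suc k)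
  have "(x + k, x + Suc k) \<in> cycle_edges n"
    using Suc.prems assms(1) by (simp add: cycle_edges_def Omega_def)
  then show ?case using Suc by auto
qed simp

lemma cycle_walk_sym:
  assumes "(x, y) \<in> cycle_edges n ^^ k"
  shows "(y, x) \<in> cycle_edges n ^^ k"
  using assms
proof (induction k arbitrary: y)
  case (Suc k)
  then obtain z where "(x, z) \<in> cycle_edges n ^^ k" and zy: "(z, y) \<in> cycle_edges n"
    by auto
  moreover have "(y, z) \<in> cycle_edges n"
    using zy by (auto simp: cycle_edges_def insert_commute)
  ultimately show ?case
    using Suc.IH relpow_Suc_I2 by metis
qed simp

lemma cycle_walk_exists:
  assumes "n \<ge> 3" "x \<in> Omega n" "y \<in> Omega n" "x \<le> y"
  shows "(x, y) \<in> cycle_edges n ^^ nat (cycle_dist n x y)"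
proof (cases "y - x \<le> n - (y - x)")
  case True
  then have "nat (cycle_dist n x y) = y - x"
    using assms by (auto simp: cycle_dist_def Omega_def)
  then show ?thesis
    using cycle_walk_up[of x "y - x" n] assms by (simp add: Omega_def)
next
  case False
  have down: "(x, 1) \<in> cycle_edges n ^^ (x - 1)"
    using cycle_walk_sym[OF cycle_walk_up[of 1 "x - 1" n]] assms by (simp add: Omega_def)
  have "(1, n) \<in> cycle_edges n"
    using assms by (auto simp: cycle_edges_def Omega_def)
  with down have "(x, n) \<in> cycle_edges n ^^ (x - 1 + 1)"
    by auto
  moreover have "(n, y) \<in> cycle_edges n ^^ (n - y)"
    using cycle_walk_sym[OF cycle_walk_up[of y "n - y" n]] assms by (simp add: Omega_def)
  ultimately have "(x, y) \<in> cycle_edges n ^^ (x - 1 + 1 + (n - y))"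
    by (metis relpow_add relcompI)
  moreover have "nat (cycle_dist n x y) = x - 1 + 1 + (n - y)"
    using False assms by (auto simp: cycle_dist_def Omega_def)
  ultimately show ?thesis by simp
qed

lemma cycle_dist_geodesic:
  assumes "n \<ge> 3" "x \<in> Omega n" "y \<in> Omega n"
  shows "cycle_dist n x y = int (LEAST k. (x, y) \<in> cycle_edges n ^^ k)"
proof -
  have sym: "cycle_dist n y x = cycle_dist n x y"
    by (simp add: cycle_dist_def abs_minus_commute)
  have walk: "(x, y) \<in> cycle_edges n ^^ nat (cycle_dist n x y)"
    using cycle_walk_exists[OF assms] cycle_walk_exists[OF assms(1,3,2)] cycle_walk_sym sym
    by (metis nat_le_linear)
  have "(LEAST k. (x, y) \<in> cycle_edges n ^^ k) = nat (cycle_dist n x y)"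
    using walk cycle_dist_le_walk[OF assms(1,2)] by (intro Least_equality) force+
  moreover have "cycle_dist n x y \<ge> 0"
    using assms by (auto simp: cycle_dist_def Omega_def)
  ultimately show ?thesis by simp
qed

lemma monoid_DI: "monoid (DI n)"
proof (rule monoidI)
  fix \<alpha> \<beta> assume a: "\<alpha> \<in> carrier (DI n)" and b: "\<beta> \<in> carrier (DI n)"
  have "dom (\<beta> \<circ>\<^sub>m \<alpha>) \<subseteq> Omega n" "ran (\<beta> \<circ>\<^sub>m \<alpha>) \<subseteq> Omega n"
    using a b unfolding DI_def partial_isometries_def partial_transformations_def
    by (auto simp: map_comp_Some_iff ran_def dom_def)
  moreover have "cycle_dist n (the ((\<beta> \<circ>\<^sub>m \<alpha>) x)) (the ((\<beta> \<circ>\<^sub>m \<alpha>) y)) = cycle_dist n x y"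
    if x: "x \<in> dom (\<beta> \<circ>\<^sub>m \<alpha>)" and y: "y \<in> dom (\<beta> \<circ>\<^sub>m \<alpha>)" for x y
  proof -
    obtain u u' where u: "\<alpha> x = Some u" "\<beta> u = Some u'" using x by (auto simp: map_comp_Some_iff)
    obtain v v' where v: "\<alpha> y = Some v" "\<beta> v = Some v'" using y by (auto simp: map_comp_Some_iff)
    have "cycle_dist n u v = cycle_dist n x y"
      using a u(1) v(1) by (force simp: DI_def partial_isometries_def)
    moreover have "cycle_dist n u' v' = cycle_dist n u v"
      using b u(2) v(2) by (force simp: DI_def partial_isometries_def)
    ultimately show ?thesis using u v by simp
  qed
  ultimately show "\<alpha> \<otimes>\<^bsub>DI n\<^esub> \<beta> \<in> carrier (DI n)"
    by (simp add: DI_def partial_isometries_def partial_transformations_def)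
next
  show "\<one>\<^bsub>DI n\<^esub> \<in> carrier (DI n)"
    by (auto simp: DI_def partial_isometries_def partial_transformations_def dom_def ran_def
        split: if_splits)
next
  fix \<alpha> \<beta> \<gamma>
  show "\<alpha> \<otimes>\<^bsub>DI n\<^esub> \<beta> \<otimes>\<^bsub>DI n\<^esub> \<gamma> = \<alpha> \<otimes>\<^bsub>DI n\<^esub> (\<beta> \<otimes>\<^bsub>DI n\<^esub> \<gamma>)"
    by (auto simp: DI_def map_comp_def fun_eq_iff split: option.splits)
next
  fix \<alpha> assume "\<alpha> \<in> carrier (DI n)"
  then have dom: "dom \<alpha> \<subseteq> Omega n" and ran: "ran \<alpha> \<subseteq> Omega n"
    by (simp_all add: DI_def partial_isometries_def partial_transformations_def)
  show "\<one>\<^bsub>DI n\<^esub> \<otimes>\<^bsub>DI n\<^esub> \<alpha> = \<alpha>"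
  proof
    fix x
    have "\<alpha> x = None" if "x \<notin> Omega n" using dom that by blast
    then show "(\<one>\<^bsub>DI n\<^esub> \<otimes>\<^bsub>DI n\<^esub> \<alpha>) x = \<alpha> x" by (simp add: DI_def map_comp_def)
  qed
  show "\<alpha> \<otimes>\<^bsub>DI n\<^esub> \<one>\<^bsub>DI n\<^esub> = \<alpha>"
    using ranI[of \<alpha>] ran by (auto simp: DI_def map_comp_def fun_eq_iff split: option.splits)
qed

end

theory Submission
  imports Defs
begin

text \<open>
  Each of the three monoids contains the identity and is closed under partial inverses and
  restrictions, so \<open>\<alpha>\<close> and \<open>\<beta>\<close> are J-related iff some element of the monoid maps \<open>dom \<alpha>\<close> onto
  \<open>dom \<beta>\<close>. An order-preserving isometry between two sets of the same size exists iff their distance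
  tuples agree: at most one cyclic gap of a set exceeds \<open>n / 2\<close>, and for at least three points the
  distances between cyclic neighbours determine all gaps. An order-reversing or
  orientation-preserving isometry becomes order-preserving after composing it with the reflection
  or with a suitable rotation.
\<close>

subsection \<open>Partial isometries as injective partial maps\<close>

text \<open>For an injective partial map this is the inverse partial bijection. Otherwise the choice
  among several preimages is arbitrary, so it is characterised below only under injectivity.\<close>

definition pinv :: "('a \<rightharpoonup> 'b) \<Rightarrow> 'b \<rightharpoonup> 'a"
  where "pinv f y = (if \<exists>x. f x = Some y then Some (SOME x. f x = Some y) else None)"

lemma pinv_Some_iff:
  assumes "inj_on f (dom f)"
  shows "pinv f y = Some x \<longleftrightarrow> f x = Some y"
proof -
  have "x' = x" if "f x' = Some y" "f x = Some y" for x x'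
    using assms that by (auto simp: inj_on_def dom_def)
  then show ?thesis
    unfolding pinv_def by (auto intro: someI2)
qed

lemma partial_isometries_iff:
  "\<alpha> \<in> partial_isometries n \<longleftrightarrow>
    (\<forall>x u. \<alpha> x = Some u \<longrightarrow> x \<in> Omega n \<and> u \<in> Omega n) \<and>
    (\<forall>x u y v. \<alpha> x = Some u \<longrightarrow> \<alpha> y = Some v \<longrightarrow> cycle_dist n u v = cycle_dist n x y)"
proof -
  have "dom \<alpha> \<subseteq> Omega n \<and> ran \<alpha> \<subseteq> Omega n \<longleftrightarrow>
      (\<forall>x u. \<alpha> x = Some u \<longrightarrow> x \<in> Omega n \<and> u \<in> Omega n)"
    unfolding dom_def ran_def by blast
  moreover have "(\<forall>x\<in>dom \<alpha>. \<forall>y\<in>dom \<alpha>.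
        cycle_dist n (the (\<alpha> x)) (the (\<alpha> y)) = cycle_dist n x y) \<longleftrightarrow>
      (\<forall>x u y v. \<alpha> x = Some u \<longrightarrow> \<alpha> y = Some v \<longrightarrow> cycle_dist n u v = cycle_dist n x y)"
    by (simp add: Ball_def dom_def) (metis option.sel)
  moreover have "\<alpha> \<in> partial_isometries n \<longleftrightarrow> (dom \<alpha> \<subseteq> Omega n \<and> ran \<alpha> \<subseteq> Omega n) \<and>
      (\<forall>x\<in>dom \<alpha>. \<forall>y\<in>dom \<alpha>. cycle_dist n (the (\<alpha> x)) (the (\<alpha> y)) = cycle_dist n x y)"
    unfolding partial_isometries_def partial_transformations_def by simp
  ultimately show ?thesis by argo
qed

lemma cycle_dist_eq_0_iff:
  assumes "x \<in> Omega n" "y \<in> Omega n"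
  shows "cycle_dist n x y = 0 \<longleftrightarrow> x = y"
  using assms unfolding cycle_dist_def Omega_def by (auto simp: min_def)

text \<open>Points with a common image are at the distance 0 of that image from itself, and distance
  0 means equality inside \<open>Omega n\<close>.\<close>

lemma partial_isometry_inj:
  assumes "\<alpha> \<in> partial_isometries n"
  shows "inj_on \<alpha> (dom \<alpha>)"
proof (rule inj_onI)
  fix x y assume "x \<in> dom \<alpha>" "y \<in> dom \<alpha>" and eq: "\<alpha> x = \<alpha> y"
  then obtain u where u: "\<alpha> x = Some u" "\<alpha> y = Some u" by auto
  then have "cycle_dist n x y = cycle_dist n u u" "x \<in> Omega n" "y \<in> Omega n" "u \<in> Omega n"
    using assms unfolding partial_isometries_iff by metis+
  then show "x = y" using cycle_dist_eq_0_iff by metis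
qed

lemmas pinv_isometry_Some_iff = pinv_Some_iff[OF partial_isometry_inj]

lemma partial_isometries_comp:
  assumes "\<alpha> \<in> partial_isometries n" "\<beta> \<in> partial_isometries n"
  shows "\<beta> \<circ>\<^sub>m \<alpha> \<in> partial_isometries n"
  using monoid.m_closed[OF monoid_DI, of \<alpha> n \<beta>] assms by (simp add: DI_def)

lemma partial_isometries_pinv:
  assumes "\<alpha> \<in> partial_isometries n"
  shows "pinv \<alpha> \<in> partial_isometries n"
  unfolding partial_isometries_iff pinv_isometry_Some_iff[OF assms]
  using assms unfolding partial_isometries_iff by metis

lemma partial_isometries_restrict:
  assumes "\<alpha> \<in> partial_isometries n"
  shows "\<alpha> |` S \<in> partial_isometries n"
  using assms unfolding partial_isometries_iff by (auto simp: restrict_map_def split: if_splits)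

lemma partial_isometries_one: "\<one>\<^bsub>DI n\<^esub> \<in> partial_isometries n"
  using monoid.one_closed[OF monoid_DI, of n] by (simp add: DI_def)

lemma finite_dom_partial_isometry:
  assumes "\<alpha> \<in> partial_isometries n"
  shows "finite (dom \<alpha>)"
proof (rule finite_subset)
  show "dom \<alpha> \<subseteq> Omega n" using assms by (auto simp: partial_isometries_iff)
qed (simp add: Omega_def)

lemma dom_map_comp:
  assumes "ran \<alpha> \<subseteq> dom \<beta>"
  shows "dom (\<beta> \<circ>\<^sub>m \<alpha>) = dom \<alpha>"
  using assms by (auto simp: dom_def ran_def map_comp_Some_iff)

lemma ran_eq_the_image: "ran \<alpha> = (\<lambda>x. the (\<alpha> x)) ` dom \<alpha>"
  by (force simp: ran_def)

lemma card_ran_inj: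
  assumes "inj_on \<alpha> (dom \<alpha>)"
  shows "card (ran \<alpha>) = card (dom \<alpha>)"
proof -
  have "inj_on (\<lambda>x. the (\<alpha> x)) (dom \<alpha>)"
    using assms unfolding inj_on_def by (metis domIff option.expand)
  then show ?thesis by (simp add: ran_eq_the_image card_image)
qed

subsection \<open>Green's relation J in inverse submonoids closed under restriction\<close>

text \<open>Collects what the three monoids share, so that Green's relation is treated once. Closure
  under \<open>pinv\<close> supplies the missing outer factor of a product, and closure under
  restriction allows a factor to be cut down to a given domain.\<close>

locale restriction_closed =
  fixes n :: nat and C :: "(nat \<rightharpoonup> nat) set"
  assumes isometries: "C \<subseteq> partial_isometries n"
    and one_in: "\<one>\<^bsub>DI n\<^esub> \<in> C"
    and comp_in: "\<alpha> \<in> C \<Longrightarrow> \<beta> \<in> C \<Longrightarrow> \<beta> \<circ>\<^sub>m \<alpha> \<in> C"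
    and pinv_in: "\<alpha> \<in> C \<Longrightarrow> pinv \<alpha> \<in> C"
    and restrict_in: "\<alpha> \<in> C \<Longrightarrow> \<alpha> |` S \<in> C"
begin

abbreviation M :: "(nat \<rightharpoonup> nat) monoid"
  where "M \<equiv> (DI n)\<lparr>carrier := C\<rparr>"

lemma monoid_M: "monoid M"
proof -
  interpret monoid "DI n" by (rule monoid_DI)
  have C: "\<alpha> \<in> carrier (DI n)" if "\<alpha> \<in> C" for \<alpha>
    using isometries that by (auto simp: DI_def)
  show ?thesis
  proof (rule monoidI)
    show "\<alpha> \<otimes>\<^bsub>M\<^esub> \<beta> \<in> carrier M" if "\<alpha> \<in> carrier M" "\<beta> \<in> carrier M" for \<alpha> \<beta>
      using comp_in that by (simp add: DI_def)
  qed (auto simp: one_in m_assoc C)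
qed

text \<open>In the product \<open>x\<close> acts first, so it must be defined on all of
  \<open>dom \<alpha>\<close> and send it into \<open>dom \<beta>\<close>; being injective, it keeps
  the number of points.\<close>

lemma factor_of_J_class:
  assumes "\<alpha> \<in> C" "x \<in> C" "\<beta> \<in> C" "y \<in> C" "\<alpha> = x \<otimes>\<^bsub>M\<^esub> \<beta> \<otimes>\<^bsub>M\<^esub> y"
  shows "ran (x |` dom \<alpha>) \<subseteq> dom \<beta>" "dom (x |` dom \<alpha>) = dom \<alpha>"
    "card (ran (x |` dom \<alpha>)) = card (dom \<alpha>)" "card (dom \<alpha>) \<le> card (dom \<beta>)"
proof -
  have \<alpha>: "\<alpha> = y \<circ>\<^sub>m (\<beta> \<circ>\<^sub>m x)" using assms by (simp add: DI_def)
  show ran: "ran (x |` dom \<alpha>) \<subseteq> dom \<beta>"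
    unfolding \<alpha> by (auto simp: ran_def restrict_map_def map_comp_Some_iff split: if_splits)
  show dom: "dom (x |` dom \<alpha>) = dom \<alpha>"
    unfolding \<alpha> by (auto simp: restrict_map_def map_comp_Some_iff split: if_splits)
  show card: "card (ran (x |` dom \<alpha>)) = card (dom \<alpha>)"
    using card_ran_inj[OF partial_isometry_inj[OF partial_isometries_restrict[of x n "dom \<alpha>"]]]
      assms(2) isometries dom by auto
  show "card (dom \<alpha>) \<le> card (dom \<beta>)"
    using card_mono[OF finite_dom_partial_isometry ran, of n] card assms(3) isometries by auto
qed

lemma two_sided_ideal_mono:
  assumes \<alpha>: "\<alpha> \<in> C" and \<beta>: "\<beta> \<in> C" and x: "x \<in> C" "dom x = dom \<alpha>" "ran x = dom \<beta>"
  shows "two_sided_ideal M \<alpha> \<subseteq> two_sided_ideal M \<beta>"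
proof -
  interpret monoid M by (rule monoid_M)
  \<comment> \<open>From left to right, \<open>y\<close> undoes \<beta>, then undoes
    \<open>x\<close>, then applies \<alpha>. Since \<open>ran x = dom \<beta>\<close>, no point is
    lost on the way, and the product of \<open>x\<close>, \<beta> and \<open>y\<close> is
    \<alpha>.\<close>
  define y where "y = \<alpha> \<circ>\<^sub>m (pinv x \<circ>\<^sub>m pinv \<beta>)"
  have y: "y \<in> C" unfolding y_def by (intro comp_in pinv_in \<alpha> \<beta> x)
  have inv: "pinv x v = Some u \<longleftrightarrow> x u = Some v" "pinv \<beta> v = Some u \<longleftrightarrow> \<beta> u = Some v" for u v
    using isometries x(1) \<beta> pinv_isometry_Some_iff by blast+
  have "\<alpha> i = (y \<circ>\<^sub>m (\<beta> \<circ>\<^sub>m x)) i" for i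
  proof (cases "x i")
    case None
    then have "\<alpha> i = None" using x(2) by blast
    with None show ?thesis by (simp add: map_comp_def)
  next
    case (Some j)
    then obtain k where "\<beta> j = Some k" using x(3) ranI[of x] by blast
    moreover have "pinv \<beta> k = Some j" "pinv x j = Some i" using calculation Some inv by auto
    ultimately show ?thesis using Some by (simp add: y_def map_comp_def)
  qed
  then have \<alpha>_eq: "\<alpha> = x \<otimes>\<^bsub>M\<^esub> \<beta> \<otimes>\<^bsub>M\<^esub> y" by (auto simp: DI_def)
  show ?thesis
  proof
    fix z assume "z \<in> two_sided_ideal M \<alpha>"
    then obtain u v where uv: "u \<in> carrier M" "v \<in> carrier M" and z: "z = u \<otimes>\<^bsub>M\<^esub> \<alpha> \<otimes>\<^bsub>M\<^esub> v"
      unfolding two_sided_ideal_def by blast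
    have C: "x \<in> carrier M" "y \<in> carrier M" "\<beta> \<in> carrier M" using x y \<beta> by auto
    have "z = (u \<otimes>\<^bsub>M\<^esub> x) \<otimes>\<^bsub>M\<^esub> \<beta> \<otimes>\<^bsub>M\<^esub> (y \<otimes>\<^bsub>M\<^esub> v)"
      unfolding z \<alpha>_eq using uv C by (simp only: m_assoc m_closed)
    then show "z \<in> two_sided_ideal M \<beta>"
      unfolding two_sided_ideal_def using uv C m_closed by blast
  qed
qed

lemma in_own_ideal:
  assumes "\<alpha> \<in> C"
  shows "\<alpha> \<in> two_sided_ideal M \<alpha>"
proof -
  interpret monoid M by (rule monoid_M)
  have "\<alpha> = \<one>\<^bsub>M\<^esub> \<otimes>\<^bsub>M\<^esub> \<alpha> \<otimes>\<^bsub>M\<^esub> \<one>\<^bsub>M\<^esub>" using assms r_one[of \<alpha>] l_one[of \<alpha>] by simp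
  then show ?thesis unfolding two_sided_ideal_def using one_closed by blast
qed

text \<open>If each element is a multiple of the other, their domains have equal size, so the left
  factor cut down to \<open>dom \<alpha>\<close> is onto \<open>dom \<beta>\<close>. Conversely, a
  bijection between the domains and its inverse give the two inclusions of ideals.\<close>

lemma Green_J_iff:
  assumes \<alpha>: "\<alpha> \<in> C" and \<beta>: "\<beta> \<in> C"
  shows "Green_J M \<alpha> \<beta> \<longleftrightarrow> (\<exists>x\<in>C. dom x = dom \<alpha> \<and> ran x = dom \<beta>)"
proof
  assume J: "Green_J M \<alpha> \<beta>"
  then have "\<alpha> \<in> two_sided_ideal M \<beta>" "\<beta> \<in> two_sided_ideal M \<alpha>"
    using in_own_ideal \<alpha> \<beta> unfolding Green_J_def by blast+
  then obtain x y z w where C: "x \<in> C" "y \<in> C" "z \<in> C" "w \<in> C"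
    and eq: "\<alpha> = x \<otimes>\<^bsub>M\<^esub> \<beta> \<otimes>\<^bsub>M\<^esub> y" "\<beta> = z \<otimes>\<^bsub>M\<^esub> \<alpha> \<otimes>\<^bsub>M\<^esub> w"
    unfolding two_sided_ideal_def by auto
  note f = factor_of_J_class[OF \<alpha> C(1) \<beta> C(2) eq(1)]
  have "card (dom \<beta>) \<le> card (dom \<alpha>)"
    using factor_of_J_class(4)[OF \<beta> C(3) \<alpha> C(4) eq(2)] .
  then have "ran (x |` dom \<alpha>) = dom \<beta>"
    using f finite_dom_partial_isometry \<beta> isometries by (metis card_subset_eq le_antisym subsetD)
  then show "\<exists>x\<in>C. dom x = dom \<alpha> \<and> ran x = dom \<beta>"
    using f(2) restrict_in[OF C(1)] by blast
next
  assume "\<exists>x\<in>C. dom x = dom \<alpha> \<and> ran x = dom \<beta>"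
  then obtain x where x: "x \<in> C" "dom x = dom \<alpha>" "ran x = dom \<beta>" by blast
  have "pinv x v = Some u \<longleftrightarrow> x u = Some v" for u v
    using isometries x(1) pinv_isometry_Some_iff by blast
  then have "dom (pinv x) = ran x" "ran (pinv x) = dom x"
    by (auto simp: ran_def dom_def)
  then show "Green_J M \<alpha> \<beta>"
    unfolding Green_J_def
    using two_sided_ideal_mono[OF \<alpha> \<beta> x] two_sided_ideal_mono[OF \<beta> \<alpha> pinv_in[OF x(1)]] x by auto
qed

text \<open>Meant for the reflection and the powers of the rotation. The set
  \<open>dom (\<beta> \<circ>\<^sub>m r)\<close> is the preimage of \<open>dom \<beta>\<close> under
  \<open>r\<close>, so following \<open>x\<close> by \<open>r\<close> or by its inverse moves the
  image of \<open>x\<close> between these two sets.\<close>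

lemma transport_along_permutation:
  assumes r: "r \<in> C" "dom r = Omega n" "ran r = Omega n" and B: "dom \<beta> \<subseteq> Omega n"
  shows "x \<in> C \<Longrightarrow> ran x = dom (\<beta> \<circ>\<^sub>m r) \<Longrightarrow>
      r \<circ>\<^sub>m x \<in> C \<and> dom (r \<circ>\<^sub>m x) = dom x \<and> ran (r \<circ>\<^sub>m x) = dom \<beta>"
    and "x \<in> C \<Longrightarrow> ran x = dom \<beta> \<Longrightarrow>
      pinv r \<circ>\<^sub>m x \<in> C \<and> dom (pinv r \<circ>\<^sub>m x) = dom x \<and> ran (pinv r \<circ>\<^sub>m x) = dom (\<beta> \<circ>\<^sub>m r)"
proof -
  have inv: "pinv r v = Some u \<longleftrightarrow> r u = Some v" for u v
    using isometries r(1) pinv_isometry_Some_iff by blast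
  have surj: "\<exists>u. r u = Some v" if "v \<in> dom \<beta>" for v
    using r(3) B that unfolding ran_def by blast
  show "r \<circ>\<^sub>m x \<in> C \<and> dom (r \<circ>\<^sub>m x) = dom x \<and> ran (r \<circ>\<^sub>m x) = dom \<beta>"
    if x: "x \<in> C" "ran x = dom (\<beta> \<circ>\<^sub>m r)"
  proof (intro conjI)
    show "dom (r \<circ>\<^sub>m x) = dom x" by (rule dom_map_comp) (auto simp: x map_comp_Some_iff)
    show "ran (r \<circ>\<^sub>m x) = dom \<beta>"
    proof
      show "ran (r \<circ>\<^sub>m x) \<subseteq> dom \<beta>"
      proof
        fix v assume "v \<in> ran (r \<circ>\<^sub>m x)"
        then obtain i u where "x i = Some u" "r u = Some v"
          by (auto simp: ran_def map_comp_Some_iff)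
        moreover have "u \<in> dom (\<beta> \<circ>\<^sub>m r)" using calculation(1) x(2) ranI[of x] by blast
        ultimately show "v \<in> dom \<beta>" by (auto simp: map_comp_Some_iff)
      qed
      show "dom \<beta> \<subseteq> ran (r \<circ>\<^sub>m x)"
      proof
        fix v assume v: "v \<in> dom \<beta>"
        then obtain u where u: "r u = Some v" using surj by blast
        then have "u \<in> ran x" using v x(2) by (auto simp: map_comp_Some_iff)
        then show "v \<in> ran (r \<circ>\<^sub>m x)" using u by (auto simp: ran_def map_comp_Some_iff)
      qed
    qed
  qed (intro comp_in x r)
  show "pinv r \<circ>\<^sub>m x \<in> C \<and> dom (pinv r \<circ>\<^sub>m x) = dom x \<and> ran (pinv r \<circ>\<^sub>m x) = dom (\<beta> \<circ>\<^sub>m r)"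
    if x: "x \<in> C" "ran x = dom \<beta>"
  proof (intro conjI)
    show "dom (pinv r \<circ>\<^sub>m x) = dom x"
      using surj by (intro dom_map_comp) (auto simp: x dom_def inv)
    have "u \<in> ran (pinv r \<circ>\<^sub>m x) \<longleftrightarrow> (\<exists>v\<in>ran x. r u = Some v)" for u
      by (auto simp: ran_def map_comp_Some_iff inv)
    then show "ran (pinv r \<circ>\<^sub>m x) = dom (\<beta> \<circ>\<^sub>m r)"
      by (auto simp: x map_comp_Some_iff)
  qed (intro comp_in pinv_in x r)
qed

lemma card_dom_comp_permutation:
  assumes r: "r \<in> C" "dom r = Omega n" "ran r = Omega n" and B: "dom \<beta> \<subseteq> Omega n"
  shows "card (dom (\<beta> \<circ>\<^sub>m r)) = card (dom \<beta>)"
proof -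
  \<comment> \<open>The identity on \<open>dom \<beta>\<close>, followed by the inverse of
    \<open>r\<close>, is a bijection from \<open>dom \<beta>\<close> onto the preimage.\<close>
  let ?e = "\<one>\<^bsub>DI n\<^esub> |` dom \<beta>"
  have "dom ?e = dom \<beta>" "ran ?e = dom \<beta>"
    using subsetD[OF B, OF domI] by (auto simp: DI_def restrict_map_def ran_def split: if_splits)
  then obtain y where "y \<in> C" "dom y = dom \<beta>" "ran y = dom (\<beta> \<circ>\<^sub>m r)"
    using transport_along_permutation(2)[OF r B restrict_in[OF one_in]] by metis
  then show ?thesis using card_ran_inj partial_isometry_inj isometries by (metis subsetD)
qed

end

subsection \<open>Order-preserving isometries and distance tuples\<close>

lemma order_preserving_iff:
  "order_preserving \<alpha> \<longleftrightarrow> (\<forall>x u y v. \<alpha> x = Some u \<longrightarrow> \<alpha> y = Some v \<longrightarrow> x \<le> y \<longrightarrow> u \<le> v)"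
  unfolding order_preserving_def monotone_on_def by (force simp: dom_def)

lemma order_reversing_iff:
  "order_reversing \<alpha> \<longleftrightarrow> (\<forall>x u y v. \<alpha> x = Some u \<longrightarrow> \<alpha> y = Some v \<longrightarrow> x \<le> y \<longrightarrow> v \<le> u)"
  unfolding order_reversing_def monotone_on_def by (force simp: dom_def)

text \<open>A value of \<open>min d (n - d)\<close> determines \<open>d\<close> up to exchange with
  its complement \<open>n - d\<close>.\<close>

lemma cycle_dist_le_cases:
  assumes "x \<le> y" "z \<le> w" "cycle_dist n x y = cycle_dist n z w"
  shows "int y - int x = int w - int z \<or> int y - int x + (int w - int z) = int n"
  using assms unfolding cycle_dist_def by (simp add: min_def split: if_splits)

text \<open>One inequality suffices because the assumptions are symmetric in \<open>f\<close> and
  \<open>g\<close>. The bounds by \<open>n\<close> say that each sequence goes round the cycle less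
  than once, and \<open>m \<ge> 2\<close> supplies a second gap, which rules out complementary gaps
  at \<open>p\<close>.\<close>

lemma gap_eq:
  fixes f g :: "nat \<Rightarrow> nat"
  assumes m: "m \<ge> 2"
    and f: "strict_mono_on {..m} f" "f m < f 0 + n"
    and g: "strict_mono_on {..m} g" "g m < g 0 + n"
    and step: "\<And>p. p < m \<Longrightarrow> cycle_dist n (f p) (f (Suc p)) = cycle_dist n (g p) (g (Suc p))"
    and wrap: "cycle_dist n (f 0) (f m) = cycle_dist n (g 0) (g m)"
    and p: "p < m"
  shows "f (Suc p) + g p \<le> g (Suc p) + f p"
proof (rule ccontr)
  assume "\<not> ?thesis"
  then have gt: "int (f (Suc p)) - int (f p) > int (g (Suc p)) - int (g p)" by linarith
  have fl: "f i < f j" if "i < j" "j \<le> m" for i j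
    using f(1) that by (auto simp: strict_mono_on_def)
  have gl: "g i < g j" if "i < j" "j \<le> m" for i j
    using g(1) that by (auto simp: strict_mono_on_def)
  have fle: "f i \<le> f j" if "i \<le> j" "j \<le> m" for i j
    using fl[of i j] that by (cases "i = j") auto
  have gle: "g i \<le> g j" if "i \<le> j" "j \<le> m" for i j
    using gl[of i j] that by (cases "i = j") auto
  \<comment> \<open>The gaps at \<open>p\<close> differ, so equality of their distances makes them
    complementary.\<close>
  have sum: "int (f (Suc p)) - int (f p) + (int (g (Suc p)) - int (g p)) = int n"
    using cycle_dist_le_cases[OF _ _ step[OF p]] fle[of p "Suc p"] gle[of p "Suc p"] p gt by simp
  have F: "f 0 \<le> f p" "f (Suc p) \<le> f m" and G: "g 0 \<le> g p" "g (Suc p) \<le> g m"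
    using fle gle p by auto
  \<comment> \<open>All other gaps of \<open>f\<close> are small, so they agree with those of \<open>g\<close>; closing up the cycle then forces the gap at \<open>p\<close> to agree as well.\<close>
  have other: "int (f (Suc q)) - int (f q) = int (g (Suc q)) - int (g q)"
    if q: "q < m" "q \<noteq> p" for q
  proof -
    have "Suc q \<le> p \<or> Suc p \<le> q" using q by linarith
    then have "f (Suc q) \<le> f p \<and> g (Suc q) \<le> g p \<or> f (Suc p) \<le> f q \<and> g (Suc p) \<le> g q"
      using fle gle p q by auto
    moreover have "f 0 \<le> f q" "f (Suc q) \<le> f m" "f q < f (Suc q)" "g 0 \<le> g q" "g (Suc q) \<le> g m" "g q < g (Suc q)"
      using fle gle fl gl q by auto
    \<comment> \<open>The gaps at \<open>q\<close> and \<open>p\<close> do not overlap. Were those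
      at \<open>q\<close> complementary too, the total spans of \<open>f\<close> and
      \<open>g\<close> would sum to at least \<open>2 * n\<close>, although each is less than
      \<open>n\<close>.\<close>
    ultimately show ?thesis
      using cycle_dist_le_cases[OF _ _ step[OF q(1)]] sum F G f(2) g(2) by linarith
  qed
  have below: "int (f q) - int (f 0) = int (g q) - int (g 0)" if "q \<le> p" for q
    using that
  proof (induction q)
    case (Suc q) then show ?case using other[of q] p by simp
  qed simp
  have above: "int (f q) - int (f (Suc p)) = int (g q) - int (g (Suc p))" if "Suc p \<le> q" "q \<le> m" for q
    using that
  proof (induction q rule: dec_induct)
    case (step q) then show ?case using other[of q] by simp
  qed simp
  \<comment> \<open>Some gap other than the one at \<open>p\<close> exists and is positive. The
    total spans of \<open>f\<close> and \<open>g\<close> differ exactly as the gaps at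
    \<open>p\<close> do, so \<open>wrap\<close> makes them sum to \<open>n\<close>; but the gaps at
    \<open>p\<close> alone already sum to \<open>n\<close>.\<close>
  have "p > 0 \<or> Suc p < m" using m p by linarith
  then have "f 0 < f p \<or> f (Suc p) < f m" using fl p by auto
  then show False
    using cycle_dist_le_cases[OF _ _ wrap] below[of p] above[of m] gt sum F G p fle[of p "Suc p"]
      gle[of p "Suc p"]
    by linarith
qed

lemma cycle_dist_commute: "cycle_dist n x y = cycle_dist n y x"
  by (simp add: cycle_dist_def abs_minus_commute)

text \<open>From three points on, all gaps agree by \<open>gap_eq\<close>, hence all differences
  agree. With fewer points, the closing distance is the only nontrivial one.\<close>

lemma pairwise_dist_eq:
  fixes f g :: "nat \<Rightarrow> nat"
  assumes f: "strict_mono_on {..m} f" "f m < f 0 + n"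
    and g: "strict_mono_on {..m} g" "g m < g 0 + n"
    and step: "\<And>p. p < m \<Longrightarrow> cycle_dist n (f p) (f (Suc p)) = cycle_dist n (g p) (g (Suc p))"
    and wrap: "cycle_dist n (f 0) (f m) = cycle_dist n (g 0) (g m)"
    and ij: "i \<le> m" "j \<le> m"
  shows "cycle_dist n (f i) (f j) = cycle_dist n (g i) (g j)"
proof (cases "m \<ge> 2")
  case True
  have gap: "int (f (Suc p)) - int (f p) = int (g (Suc p)) - int (g p)" if "p < m" for p
    using gap_eq[OF True f g step wrap that]
      gap_eq[OF True g f step[symmetric] wrap[symmetric] that] by linarith
  have "int (f q) - int (f 0) = int (g q) - int (g 0)" if "q \<le> m" for q
    using that
  proof (induction q)
    case (Suc q) then show ?case using gap[of q] by simp
  qed simp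
  from this[OF ij(1)] this[OF ij(2)] have "int (f i) - int (f j) = int (g i) - int (g j)" by linarith
  then show ?thesis by (simp add: cycle_dist_def)
next
  case False
  then have "i = j \<or> i = 0 \<and> j = m \<or> i = m \<and> j = 0" using ij by auto
  then show ?thesis using wrap cycle_dist_commute by (auto simp: cycle_dist_def)
qed

lemma dist_tuple_eq_iff:
  assumes "finite A" "finite B" and k: "card A = k" "card B = k"
  shows "dist_tuple n A = dist_tuple n B \<longleftrightarrow>
    (\<forall>p < k - 1. cycle_dist n (sorted_list_of_set A ! p) (sorted_list_of_set A ! Suc p)
      = cycle_dist n (sorted_list_of_set B ! p) (sorted_list_of_set B ! Suc p)) \<and>
    cycle_dist n (sorted_list_of_set A ! 0) (sorted_list_of_set A ! (k - 1))
      = cycle_dist n (sorted_list_of_set B ! 0) (sorted_list_of_set B ! (k - 1))"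
  using k unfolding dist_tuple_def Let_def by auto

text \<open>An order-preserving bijection must send the \<open>p\<close>-th smallest element of
  \<open>A\<close> to the \<open>p\<close>-th smallest of \<open>B\<close>, so there is a single
  candidate. Equality of the tuples states that it keeps the distances between cyclic neighbours,
  and \<open>pairwise_dist_eq\<close> extends this to all pairs.\<close>

lemma order_isometry_iff:
  assumes A: "A \<subseteq> Omega n" and B: "B \<subseteq> Omega n"
  shows "(\<exists>x \<in> partial_isometries n. order_preserving x \<and> dom x = A \<and> ran x = B) \<longleftrightarrow>
    card A = card B \<and> (card B \<le> 1 \<or> dist_tuple n A = dist_tuple n B)"
    (is "?L \<longleftrightarrow> ?R")
proof -
  have fin: "finite A" "finite B" using A B finite_subset by (auto simp: Omega_def)
  define xs ys where "xs = sorted_list_of_set A" and "ys = sorted_list_of_set B"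
  have xs: "set xs = A" "sorted_wrt (<) xs" "length xs = card A"
    and ys: "set ys = B" "sorted_wrt (<) ys" "length ys = card B"
    using fin by (simp_all add: xs_def ys_def)
  show ?thesis
  proof
    assume ?L
    then obtain x where x: "x \<in> partial_isometries n" "order_preserving x" "dom x = A" "ran x = B"
      by blast
    let ?f = "\<lambda>i. the (x i)"
    have card: "card A = card B"
      using card_ran_inj[OF partial_isometry_inj[OF x(1)]] x by simp
    have img: "set (map ?f xs) = B" using x xs by (simp add: ran_eq_the_image)
    have "sorted (map ?f xs)"
      using xs x(2,3) unfolding order_preserving_def sorted_map monotone_on_def
      by (auto intro: sorted_wrt_mono_rel[of xs "(<)"])
    \<comment> \<open>The list has \<open>card A = card B\<close> entries and its set is
      \<open>B\<close>, so no entry repeats.\<close>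
    moreover have "distinct (map ?f xs)"
      using img xs ys card by (metis card_distinct length_map)
    ultimately have ys_eq: "ys = map ?f xs"
      unfolding ys_def using img by (metis sorted_list_of_set.idem_if_sorted_distinct)
    have iso: "cycle_dist n (?f i) (?f j) = cycle_dist n i j" if "i \<in> A" "j \<in> A" for i j
      using x(1,3) that by (auto simp: partial_isometries_def)
    have "dist_tuple n A = dist_tuple n B" if "card B > 1"
      unfolding dist_tuple_eq_iff[OF fin card refl]
      unfolding xs_def[symmetric] ys_def[symmetric] ys_eq
      using that card xs nth_mem[of _ xs] iso by auto
    with card show ?R by linarith
  next
    assume R: ?R
    define x where "x = map_of (zip xs ys)"
    have len: "length xs = length ys" using xs ys R by simp
    have "distinct xs" using xs strict_sorted_iff by blast
    then have x_iff: "x i = Some j \<longleftrightarrow> (\<exists>p < card A. i = xs ! p \<and> j = ys ! p)" for i j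
      unfolding x_def using len xs by (auto simp: map_of_zip_is_Some in_set_zip)
    have xl: "xs ! p < xs ! q" if "p < q" "q < card A" for p q
      using sorted_wrt_nth_less[OF xs(2)] that xs by simp
    have yl: "ys ! p < ys ! q" if "p < q" "q < card A" for p q
      using sorted_wrt_nth_less[OF ys(2)] that ys R by simp
    have xO: "xs ! p \<in> Omega n" if "p < card A" for p using that xs A nth_mem by auto
    have yO: "ys ! p \<in> Omega n" if "p < card A" for p using that ys R B nth_mem by auto
    have dist: "cycle_dist n (xs ! p) (xs ! q) = cycle_dist n (ys ! p) (ys ! q)"
      if pq: "p < card A" "q < card A" for p q
    proof (cases "card B \<le> 1")
      case True
      then have "p = q" using pq R by linarith
      then show ?thesis by (simp add: cycle_dist_def)
    next
      case False
      let ?m = "card A - 1"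
      have t: "dist_tuple n A = dist_tuple n B" using False R by blast
      show ?thesis
      proof (rule pairwise_dist_eq[where m = ?m])
        show "strict_mono_on {..?m} ((!) xs)" "strict_mono_on {..?m} ((!) ys)"
          using xl yl pq by (auto simp: strict_mono_on_def)
        show "xs ! ?m < xs ! 0 + n" "ys ! ?m < ys ! 0 + n"
          using xO[of ?m] xO[of 0] yO[of ?m] yO[of 0] pq by (auto simp: Omega_def)
      qed (use t pq R dist_tuple_eq_iff[OF fin refl, of n] in \<open>auto simp: xs_def ys_def\<close>)
    qed
    have "dom x = A" unfolding x_def using len xs by simp
    moreover have "ran x = B"
      unfolding x_def using len xs ys \<open>distinct xs\<close> by (simp add: ran_map_of_zip)
    moreover have "order_preserving x"
      unfolding order_preserving_iff x_iff using xl yl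
      by (metis leD le_eq_less_or_eq linorder_neqE_nat)
    moreover have "x \<in> partial_isometries n"
      unfolding partial_isometries_iff x_iff using dist xO yO by auto
    ultimately show ?L by blast
  qed
qed

subsection \<open>Orientation-preserving isometries\<close>

text \<open>The strict ternary cyclic order on the circle. Unlike a count of descents, it passes
  directly through products, inverses and restrictions.\<close>

definition cyc :: "nat \<Rightarrow> nat \<Rightarrow> nat \<Rightarrow> bool"
  where "cyc a b c \<longleftrightarrow> a < b \<and> b < c \<or> b < c \<and> c < a \<or> c < a \<and> a < b"

lemma descent_between:
  fixes as :: "nat list"
  assumes "i \<le> j" "as ! j < as ! i"
  shows "\<exists>d. i \<le> d \<and> d < j \<and> as ! Suc d < as ! d"
  using assms
proof (induction j rule: dec_induct)
  case (step j)
  show ?case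
  proof (cases "as ! j < as ! i")
    case True then show ?thesis using step.IH less_SucI by blast
  next
    case False then show ?thesis using step by (intro exI[of _ j]) auto
  qed
qed simp

text \<open>A wrongly oriented triple makes the closed sequence fall on two disjoint arcs, each of
  which contains a descent. Conversely, two descents yield a wrongly oriented triple.\<close>

lemma cyclic_iff_cyc:
  assumes dist: "distinct as"
  shows "cyclic as \<longleftrightarrow>
    (\<forall>i j k. i < j \<longrightarrow> j < k \<longrightarrow> k < length as \<longrightarrow> cyc (as ! i) (as ! j) (as ! k))"
proof -
  let ?l = "length as"
  define D where "D = {i. i < ?l \<and> as ! i > as ! ((i + 1) mod ?l)}"
  have "finite D" by (simp add: D_def)
  then have cyclic: "cyclic as \<longleftrightarrow> (\<forall>d\<in>D. \<forall>e\<in>D. d = e)"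
    using card_le_Suc0_iff_eq[of D] by (simp add: cyclic_def D_def)
  have DI: "d \<in> D" if "Suc d < ?l" "as ! Suc d < as ! d" for d
    using that by (simp add: D_def)
  have inner: "\<exists>d\<in>D. i \<le> d \<and> d < j" if ij: "i < j" "j < ?l" "as ! j < as ! i" for i j
  proof -
    obtain d where "i \<le> d" "d < j" "as ! Suc d < as ! d"
      using descent_between[of i j as] ij by auto
    then show ?thesis using DI ij by (intro bexI[of _ d]) auto
  qed
  \<comment> \<open>The arc from \<open>k\<close> past the end and back to \<open>i\<close> falls in
    value. The descent lies in the initial segment, in the final segment or at the closing step,
    according to the three cases.\<close>
  have outer: "\<exists>d\<in>D. d < i \<or> k \<le> d" if ik: "i < k" "k < ?l" and gt: "as ! i < as ! k" for i k
  proof -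
    consider "as ! i < as ! 0" | "as ! (?l - 1) < as ! k" | "as ! 0 < as ! (?l - 1)"
      using gt by linarith
    then show ?thesis
    proof cases
      case 1 then show ?thesis using inner[of 0 i] ik by (cases "i = 0") auto
    next
      case 2
      then have "k < ?l - 1" using ik by (cases "k = ?l - 1") auto
      then show ?thesis using inner[of k "?l - 1"] 2 ik by fastforce
    next
      case 3
      moreover have "?l - 1 + 1 = ?l" using ik by linarith
      ultimately have "?l - 1 \<in> D" unfolding D_def using ik by (simp del: One_nat_def)
      then show ?thesis using ik by (intro bexI[of _ "?l - 1"]) auto
    qed
  qed
  have ne: "as ! i \<noteq> as ! j" if "i < j" "j < ?l" for i j
    using dist that by (simp add: nth_eq_iff_index_eq)
  show ?thesis
  proof
    assume c: "cyclic as"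
    show "\<forall>i j k. i < j \<longrightarrow> j < k \<longrightarrow> k < ?l \<longrightarrow> cyc (as ! i) (as ! j) (as ! k)"
    proof (intro allI impI, rule ccontr)
      fix i j k assume ijk: "i < j" "j < k" "k < ?l" and no: "\<not> cyc (as ! i) (as ! j) (as ! k)"
      have "as ! i \<noteq> as ! j" "as ! j \<noteq> as ! k" "as ! i \<noteq> as ! k" using ne ijk by auto
      \<comment> \<open>These are the three wrong orders of distinct values. Each falls on two of
        the arcs from \<open>i\<close> to \<open>j\<close>, from \<open>j\<close> to
        \<open>k\<close> and from \<open>k\<close> round to \<open>i\<close>, which gives two
        different descents.\<close>
      with no consider "as ! j < as ! i" "as ! k < as ! j" | "as ! j < as ! i" "as ! i < as ! k"
        | "as ! k < as ! j" "as ! i < as ! k"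
        unfolding cyc_def by linarith
      then show False
      proof cases
        case 1 then show ?thesis using inner[of i j] inner[of j k] c ijk unfolding cyclic by fastforce
      next
        case 2 then show ?thesis using inner[of i j] outer[of i k] c ijk unfolding cyclic by fastforce
      next
        case 3 then show ?thesis using inner[of j k] outer[of i k] c ijk unfolding cyclic by fastforce
      qed
    qed
  next
    assume tri: "\<forall>i j k. i < j \<longrightarrow> j < k \<longrightarrow> k < ?l \<longrightarrow> cyc (as ! i) (as ! j) (as ! k)"
    have False if d: "d \<in> D" and e: "e \<in> D" and "d < e" for d e
    proof -
      have de: "d < ?l" "e < ?l" and d': "as ! Suc d < as ! d" and e': "as ! ((e + 1) mod ?l) < as ! e"
        using d e \<open>d < e\<close> by (auto simp: D_def)
      \<comment> \<open>A descent at \<open>d\<close> forces every later value, by the orientation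
        of \<open>d\<close>, \<open>Suc d\<close> and that position, to lie below the value at
        \<open>d\<close>.\<close>
      have d1: "as ! e < as ! d"
      proof (cases "e = Suc d")
        case False
        then have "cyc (as ! d) (as ! Suc d) (as ! e)" using tri \<open>d < e\<close> de by simp
        then show ?thesis using d' unfolding cyc_def by linarith
      qed (use d' in simp)
      \<comment> \<open>The descent at \<open>e\<close> now contradicts a triple through
        \<open>d\<close> and \<open>e\<close>, whose third position is the one following
        \<open>e\<close>: position 0 for the closing step and \<open>Suc e\<close>
        otherwise.\<close>
      show False
      proof (cases "Suc e = ?l")
        case True
        then have e0: "as ! 0 < as ! e" using e' by simp
        show False
        proof (cases "d = 0")
          case False
          then have "cyc (as ! 0) (as ! d) (as ! e)" using tri \<open>d < e\<close> de by simp
          then show ?thesis using d1 e0 unfolding cyc_def by linarith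
        qed (use d1 e0 in simp)
      next
        case False
        then have "as ! Suc e < as ! e" "cyc (as ! d) (as ! e) (as ! Suc e)"
          using e' tri \<open>d < e\<close> de by simp_all
        then show ?thesis using d1 unfolding cyc_def by linarith
      qed
    qed
    then show "cyclic as" unfolding cyclic by (metis linorder_neqE_nat)
  qed
qed

text \<open>Injectivity makes the list of images distinct, so \<open>cyclic_iff_cyc\<close> applies.
  It speaks of ascending triples only, which is enough because \<open>cyc\<close> is invariant under
  rotating its arguments.\<close>

lemma orientation_preserving_iff:
  assumes \<alpha>: "\<alpha> \<in> partial_isometries n"
  shows "orientation_preserving \<alpha> \<longleftrightarrow>
    (\<forall>a b c u v w. \<alpha> a = Some u \<longrightarrow> \<alpha> b = Some v \<longrightarrow> \<alpha> c = Some w \<longrightarrow> cyc a b c \<longrightarrow> cyc u v w)"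
    (is "_ \<longleftrightarrow> ?R")
proof -
  define xs where "xs = sorted_list_of_set (dom \<alpha>)"
  let ?f = "\<lambda>x. the (\<alpha> x)"
  have xs: "set xs = dom \<alpha>" "sorted_wrt (<) xs" "distinct xs"
    using finite_dom_partial_isometry[OF \<alpha>] by (simp_all add: xs_def)
  have "inj_on ?f (dom \<alpha>)"
    using partial_isometry_inj[OF \<alpha>] unfolding inj_on_def by (metis domIff option.expand)
  then have "distinct (map ?f xs)" using xs by (simp add: distinct_map)
  then have op: "orientation_preserving \<alpha> \<longleftrightarrow>
      (\<forall>i j k. i < j \<longrightarrow> j < k \<longrightarrow> k < length xs \<longrightarrow> cyc (?f (xs ! i)) (?f (xs ! j)) (?f (xs ! k)))"
    unfolding orientation_preserving_def xs_def[symmetric] by (simp add: cyclic_iff_cyc)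
  have less: "i < j" if "xs ! i < xs ! j" "i < length xs" "j < length xs" for i j
    using sorted_wrt_nth_less[OF xs(2), of j i] that by (metis less_asym linorder_neqE_nat)
  show ?thesis
  proof
    assume "orientation_preserving \<alpha>"
    note tri = this[unfolded op, rule_format]
    have asc: "cyc u v w"
      if s: "\<alpha> a = Some u" "\<alpha> b = Some v" "\<alpha> c = Some w" and o: "a < b" "b < c" for a b c u v w
    proof -
      have "a \<in> set xs" "b \<in> set xs" "c \<in> set xs" using s xs by auto
      then obtain i j k where "a = xs ! i" "b = xs ! j" "c = xs ! k"
        "i < length xs" "j < length xs" "k < length xs" by (metis in_set_conv_nth)
      then show ?thesis using tri[of i j k] less o s by auto
    qed
    show ?R
    proof (intro allI impI)
      fix a b c u v w
      assume "\<alpha> a = Some u" "\<alpha> b = Some v" "\<alpha> c = Some w" "cyc a b c"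
      \<comment> \<open>A triple in cyclic order is a rotation of an ascending one; the three
        instances cover the three rotations.\<close>
      then show "cyc u v w"
        using asc[of a u b v c w] asc[of b v c w a u] asc[of c w a u b v]
        unfolding cyc_def by blast
    qed
  next
    assume R: ?R
    show "orientation_preserving \<alpha>"
      unfolding op
    proof (intro allI impI)
      fix i j k assume ijk: "i < j" "j < k" "k < length xs"
      then have "xs ! i \<in> dom \<alpha>" "xs ! j \<in> dom \<alpha>" "xs ! k \<in> dom \<alpha>"
        unfolding xs(1)[symmetric] by auto
      moreover have "cyc (xs ! i) (xs ! j) (xs ! k)"
        using sorted_wrt_nth_less[OF xs(2)] ijk by (simp add: cyc_def)
      ultimately show "cyc (?f (xs ! i)) (?f (xs ! j)) (?f (xs ! k))"
        using R by (auto simp: dom_def)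
    qed
  qed
qed

text \<open>By injectivity the map is strictly increasing, hence keeps each of the three linear
  orders that make up \<open>cyc\<close>.\<close>

lemma orientation_preservingI:
  assumes \<alpha>: "\<alpha> \<in> partial_isometries n" and ord: "order_preserving \<alpha>"
  shows "orientation_preserving \<alpha>"
proof -
  have lt: "u < v" if "\<alpha> a = Some u" "\<alpha> b = Some v" "a < b" for a b u v
  proof -
    have "u \<le> v" using ord that by (auto simp: order_preserving_iff)
    moreover have "u \<noteq> v"
      using that inj_onD[OF partial_isometry_inj[OF \<alpha>], of a b] by auto
    ultimately show ?thesis by simp
  qed
  show ?thesis
    unfolding orientation_preserving_iff[OF \<alpha>] cyc_def using lt by metis
qed

subsection \<open>The three monoids\<close>

lemma one_DI_Some_iff: "\<one>\<^bsub>DI n\<^esub> x = Some y \<longleftrightarrow> x \<in> Omega n \<and> y = x"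
  by (auto simp: DI_def)

lemma restrict_Some_iff: "(\<alpha> |` S) x = Some y \<longleftrightarrow> x \<in> S \<and> \<alpha> x = Some y"
  by (auto simp: restrict_map_def)

lemma order_preserving_pinv:
  assumes \<alpha>: "\<alpha> \<in> partial_isometries n" and ord: "order_preserving \<alpha>"
  shows "order_preserving (pinv \<alpha>)"
  unfolding order_preserving_iff pinv_isometry_Some_iff[OF \<alpha>]
proof (intro allI impI)
  fix u a v b assume s: "\<alpha> a = Some u" "\<alpha> b = Some v" and "u \<le> v"
  show "a \<le> b"
  proof (rule ccontr)
    assume "\<not> a \<le> b"
    then have "v \<le> u" using ord s unfolding order_preserving_iff by (meson nat_le_linear)
    then show False
      using inj_onD[OF partial_isometry_inj[OF \<alpha>], of a b] s \<open>u \<le> v\<close> \<open>\<not> a \<le> b\<close> by auto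
  qed
qed

lemma order_reversing_pinv:
  assumes \<alpha>: "\<alpha> \<in> partial_isometries n" and ord: "order_reversing \<alpha>"
  shows "order_reversing (pinv \<alpha>)"
  unfolding order_reversing_iff pinv_isometry_Some_iff[OF \<alpha>]
proof (intro allI impI)
  fix u a v b assume s: "\<alpha> a = Some u" "\<alpha> b = Some v" and "u \<le> v"
  show "b \<le> a"
  proof (rule ccontr)
    assume "\<not> b \<le> a"
    then have "v \<le> u" using ord s unfolding order_reversing_iff by (meson nat_le_linear)
    then show False
      using inj_onD[OF partial_isometry_inj[OF \<alpha>], of a b] s \<open>u \<le> v\<close> \<open>\<not> b \<le> a\<close> by auto
  qed
qed

lemma monotone_comp:
  shows "order_preserving \<alpha> \<Longrightarrow> order_preserving \<beta> \<Longrightarrow> order_preserving (\<beta> \<circ>\<^sub>m \<alpha>)"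
    and "order_preserving \<alpha> \<Longrightarrow> order_reversing \<beta> \<Longrightarrow> order_reversing (\<beta> \<circ>\<^sub>m \<alpha>)"
    and "order_reversing \<alpha> \<Longrightarrow> order_preserving \<beta> \<Longrightarrow> order_reversing (\<beta> \<circ>\<^sub>m \<alpha>)"
    and "order_reversing \<alpha> \<Longrightarrow> order_reversing \<beta> \<Longrightarrow> order_preserving (\<beta> \<circ>\<^sub>m \<alpha>)"
  unfolding order_preserving_iff order_reversing_iff map_comp_Some_iff by blast+

lemma monotone_restrict:
  shows "order_preserving \<alpha> \<Longrightarrow> order_preserving (\<alpha> |` S)"
    and "order_reversing \<alpha> \<Longrightarrow> order_reversing (\<alpha> |` S)"
  unfolding order_preserving_iff order_reversing_iff restrict_Some_iff by blast+

lemma order_preserving_one: "order_preserving \<one>\<^bsub>DI n\<^esub>"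
  unfolding order_preserving_iff one_DI_Some_iff by blast

interpretation odi: restriction_closed n "{\<alpha> \<in> partial_isometries n. order_preserving \<alpha>}" for n
  by unfold_locales
    (auto intro: partial_isometries_one partial_isometries_comp partial_isometries_pinv
      partial_isometries_restrict order_preserving_one monotone_comp order_preserving_pinv
      monotone_restrict)

interpretation mdi: restriction_closed n
  "{\<alpha> \<in> partial_isometries n. order_preserving \<alpha> \<or> order_reversing \<alpha>}" for n
  by unfold_locales
    (auto intro: partial_isometries_one partial_isometries_comp partial_isometries_pinv
      partial_isometries_restrict order_preserving_one monotone_comp order_preserving_pinv
      order_reversing_pinv monotone_restrict)

interpretation opdi: restriction_closed n "{\<alpha> \<in> partial_isometries n. orientation_preserving \<alpha>}" for n
proof (unfold_locales, goal_cases)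
  case 2
  then show ?case
    using partial_isometries_one order_preserving_one orientation_preservingI by blast
next
  case (3 \<alpha> \<beta>)
  then have c: "\<beta> \<circ>\<^sub>m \<alpha> \<in> partial_isometries n" by (simp add: partial_isometries_comp)
  have \<alpha>: "cyc u v w" if "\<alpha> a = Some u" "\<alpha> b = Some v" "\<alpha> c = Some w" "cyc a b c" for a b c u v w
    using 3(1) that by (auto simp: orientation_preserving_iff)
  have \<beta>: "cyc u v w" if "\<beta> a = Some u" "\<beta> b = Some v" "\<beta> c = Some w" "cyc a b c" for a b c u v w
    using 3(2) that by (auto simp: orientation_preserving_iff)
  have "orientation_preserving (\<beta> \<circ>\<^sub>m \<alpha>)"
    unfolding orientation_preserving_iff[OF c] map_comp_Some_iff using \<alpha> \<beta> by blast
  with c show ?case by simp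
next
  case (4 \<alpha>)
  then have \<alpha>: "\<alpha> \<in> partial_isometries n" and op: "orientation_preserving \<alpha>" by auto
  have p: "pinv \<alpha> \<in> partial_isometries n" using partial_isometries_pinv[OF \<alpha>] .
  have "orientation_preserving (pinv \<alpha>)"
    unfolding orientation_preserving_iff[OF p] pinv_isometry_Some_iff[OF \<alpha>]
  proof (intro allI impI, rule ccontr)
    fix u v w a b c
    assume s: "\<alpha> a = Some u" "\<alpha> b = Some v" "\<alpha> c = Some w" and uvw: "cyc u v w" and no: "\<not> cyc a b c"
    have "a \<noteq> b" "b \<noteq> c" "a \<noteq> c" using s uvw by (auto simp: cyc_def)
    \<comment> \<open>Three distinct points have exactly one of the two orientations, so the
      opposite one holds and is carried by \<alpha> to the images.\<close>
    then have "cyc a c b" using no unfolding cyc_def by linarith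
    then have "cyc u w v" using op s unfolding orientation_preserving_iff[OF \<alpha>] by blast
    then show False using uvw unfolding cyc_def by linarith
  qed
  with p show ?case by simp
next
  case (5 \<alpha> S)
  then have r: "\<alpha> |` S \<in> partial_isometries n" by (simp add: partial_isometries_restrict)
  have \<alpha>: "cyc u v w" if "\<alpha> a = Some u" "\<alpha> b = Some v" "\<alpha> c = Some w" "cyc a b c" for a b c u v w
    using 5 that by (auto simp: orientation_preserving_iff)
  have "orientation_preserving (\<alpha> |` S)"
    unfolding orientation_preserving_iff[OF r] restrict_Some_iff using \<alpha> by blast
  with r show ?case by simp
qed auto

section \<open>The reflection and the powers of the rotation as permutations of the cycle\<close>

lemma reflection_Some_iff: "reflection n i = Some j \<longleftrightarrow> i \<in> Omega n \<and> j \<in> Omega n \<and> i + j = n + 1"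
  by (auto simp: reflection_def Omega_def)

lemma reflection_props:
  shows "reflection n \<in> partial_isometries n" "order_reversing (reflection n)"
    "dom (reflection n) = Omega n" "ran (reflection n) = Omega n"
proof -
  have dist: "cycle_dist n u v = cycle_dist n x y" if "x + u = n + 1" "y + v = n + 1" for x u y v
  proof -
    have "int u - int v = int y - int x" using that by linarith
    then show ?thesis by (simp add: cycle_dist_def abs_minus_commute)
  qed
  show "reflection n \<in> partial_isometries n"
    unfolding partial_isometries_iff reflection_Some_iff using dist by blast
  show "order_reversing (reflection n)"
    unfolding order_reversing_iff reflection_Some_iff by auto
  show "dom (reflection n) = Omega n" by (auto simp: dom_def reflection_def)
  have "\<exists>i. reflection n i = Some j" if "j \<in> Omega n" for j
    using that by (intro exI[of _ "n + 1 - j"]) (auto simp: reflection_Some_iff Omega_def)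
  then show "ran (reflection n) = Omega n" by (auto simp: ran_def reflection_Some_iff)
qed

text \<open>The bound \<open>s \<le> n\<close> ensures that a single subtraction of \<open>n\<close>
  brings \<open>i + s\<close> back into \<open>Omega n\<close>.\<close>

lemma rotation_power_eq:
  assumes "n \<ge> 1" "s \<le> n"
  shows "(rotation n [^]\<^bsub>OPDI n\<^esub> s) i =
    (if i \<in> Omega n then Some (if i + s \<le> n then i + s else i + s - n) else None)"
  using assms(2)
proof (induction s)
  case 0
  then show ?case by (auto simp: nat_pow_def OPDI_def DI_def Omega_def)
next
  case (Suc s)
  have "(rotation n [^]\<^bsub>OPDI n\<^esub> Suc s) i = (rotation n \<circ>\<^sub>m (rotation n [^]\<^bsub>OPDI n\<^esub> s)) i"
    by (simp add: nat_pow_def OPDI_def DI_def)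
  also have "\<dots> = (if i \<in> Omega n then Some (if i + Suc s \<le> n then i + Suc s else i + Suc s - n) else None)"
  proof (cases "i \<in> Omega n")
    case True
    then have "(rotation n [^]\<^bsub>OPDI n\<^esub> s) i = Some (if i + s \<le> n then i + s else i + s - n)"
      using Suc by simp
    moreover have "rotation n (if i + s \<le> n then i + s else i + s - n) =
        Some (if i + Suc s \<le> n then i + Suc s else i + Suc s - n)"
      using Suc.prems assms(1) True by (auto simp: rotation_def Omega_def)
    ultimately show ?thesis using True by (simp add: map_comp_def)
  next
    case False
    then show ?thesis using Suc by (simp add: map_comp_def)
  qed
  finally show ?case .
qed

lemma rotation_power_props:
  fixes n s :: nat
  defines "r \<equiv> rotation n [^]\<^bsub>OPDI n\<^esub> s"
  assumes "n \<ge> 1" "s < n"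
  shows "r \<in> partial_isometries n" "orientation_preserving r"
    "dom r = Omega n" "ran r = Omega n"
proof -
  \<comment> \<open>Membership of \<open>j\<close> in \<open>Omega n\<close> selects the right one
    of the two equations and so replaces the case distinction on
    \<open>i + s \<le> n\<close>.\<close>
  have r: "r i = Some j \<longleftrightarrow> i \<in> Omega n \<and> j \<in> Omega n \<and> (j = i + s \<or> j + n = i + s)" for i j
    unfolding r_def using assms by (auto simp: rotation_power_eq Omega_def)
  have dist: "cycle_dist n u v = cycle_dist n x y" if "r x = Some u" "r y = Some v" for x y u v
  proof -
    \<comment> \<open>Wrapping shifts a difference by at most one \<open>n\<close> in either
      direction. As all differences stay below \<open>n\<close> in absolute value, a shift replaces
      the absolute value by its complement, which has the same distance.\<close>
    have "int u - int v = int x - int y \<or> int u - int v = int x - int y + int n \<or>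
        int u - int v = int x - int y - int n"
      using that unfolding r by linarith
    moreover have "\<bar>int x - int y\<bar> < int n" "\<bar>int u - int v\<bar> < int n"
      using that unfolding r Omega_def by auto
    ultimately show ?thesis unfolding cycle_dist_def by linarith
  qed
  show iso: "r \<in> partial_isometries n"
    unfolding partial_isometries_iff using dist r by blast
  show "orientation_preserving r"
    unfolding orientation_preserving_iff[OF iso] r cyc_def Omega_def atLeastAtMost_iff
    using assms(3) by (intro allI impI) linarith
  show "dom r = Omega n" unfolding r_def using assms by (auto simp: rotation_power_eq dom_def)
  have "\<exists>i. r i = Some j" if "j \<in> Omega n" for j
    using that assms(3) unfolding r Omega_def
    by (intro exI[of _ "if s < j then j - s else j + n - s"]) auto
  then show "ran r = Omega n" by (auto simp: ran_def r)
qed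

section \<open>Reduction to order-preserving isometries\<close>

lemma dom_subset_Omega:
  assumes "\<alpha> \<in> partial_isometries n"
  shows "dom \<alpha> \<subseteq> Omega n"
  using assms by (auto simp: partial_isometries_iff)

text \<open>Following an order-reversing isometry by the inverse reflection makes it
  order-preserving and replaces its image by the preimage \<open>B'\<close>; following by the
  reflection goes back.\<close>

lemma monotone_isometry_iff:
  fixes n :: nat and \<beta> :: "nat \<rightharpoonup> nat"
  defines "B' \<equiv> dom (\<beta> \<circ>\<^sub>m reflection n)"
  assumes B: "dom \<beta> \<subseteq> Omega n"
  shows "(\<exists>x \<in> {x \<in> partial_isometries n. order_preserving x \<or> order_reversing x}.
      dom x = A \<and> ran x = dom \<beta>) \<longleftrightarrow>
    (\<exists>x \<in> partial_isometries n. order_preserving x \<and> dom x = A \<and> ran x = dom \<beta>) \<or>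
    (\<exists>x \<in> partial_isometries n. order_preserving x \<and> dom x = A \<and> ran x = B')"
    (is "?L \<longleftrightarrow> ?P \<or> ?Q")
proof
  have h: "reflection n \<in> {x \<in> partial_isometries n. order_preserving x \<or> order_reversing x}"
    using reflection_props by blast
  note transport = mdi.transport_along_permutation[OF h reflection_props(3,4) B, folded B'_def]
  show "?P \<or> ?Q" if L: ?L
  proof (rule disjCI)
    assume "\<not> ?Q"
    obtain x where x: "x \<in> partial_isometries n" "order_preserving x \<or> order_reversing x"
      "dom x = A" "ran x = dom \<beta>" using L by blast
    have "\<not> order_reversing x"
    proof
      assume "order_reversing x"
      then have "order_preserving (pinv (reflection n) \<circ>\<^sub>m x)"
        using order_reversing_pinv reflection_props by (intro monotone_comp) auto
      then show False using transport(2)[of x] x \<open>\<not> ?Q\<close> by blast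
    qed
    then show ?P using x by blast
  qed
  show ?L if "?P \<or> ?Q"
    using that
  proof
    assume ?Q
    then obtain x where "x \<in> partial_isometries n" "order_preserving x" "dom x = A" "ran x = B'"
      by blast
    then show ?L using transport(1)[of x] by blast
  qed blast
qed

text \<open>An orientation-preserving map that sends its least point to 1 is order-preserving, and
  undoing a suitable rotation achieves this. Conversely, order-preserving isometries and rotations
  are orientation-preserving, hence so are their products.\<close>

lemma oriented_isometry_iff:
  fixes n :: nat and \<beta> :: "nat \<rightharpoonup> nat"
  defines "B' \<equiv> \<lambda>s. dom (\<beta> \<circ>\<^sub>m (rotation n [^]\<^bsub>OPDI n\<^esub> s))"
  assumes n: "n \<ge> 1" and A: "A \<subseteq> Omega n" and B: "dom \<beta> \<subseteq> Omega n"
  shows "(\<exists>x \<in> {x \<in> partial_isometries n. orientation_preserving x}. dom x = A \<and> ran x = dom \<beta>) \<longleftrightarrow>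
    (\<exists>s<n. \<exists>x \<in> partial_isometries n. order_preserving x \<and> dom x = A \<and> ran x = B' s)"
    (is "?L \<longleftrightarrow> ?R")
proof
  let ?r = "\<lambda>s::nat. rotation n [^]\<^bsub>OPDI n\<^esub> s"
  have r: "?r s \<in> {x \<in> partial_isometries n. orientation_preserving x}" if "s < n" for s
    using rotation_power_props n that by blast
  have B': "dom (\<beta> \<circ>\<^sub>m ?r s) = B' s" for s by (simp add: B'_def)
  note transport = opdi.transport_along_permutation[OF r
      rotation_power_props(3,4)[OF n] B, unfolded B']
  show ?R if ?L
  proof -
    obtain x where x: "x \<in> partial_isometries n" "orientation_preserving x"
      "dom x = A" "ran x = dom \<beta>" using \<open>?L\<close> by blast
    show ?thesis
    proof (cases "A = {}")
      case True
      have n0: "0 < n" using n by simp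
      \<comment> \<open>An empty map is order-preserving whatever the rotation; \<open>s = 0\<close>
        is a choice below \<open>n\<close>.\<close>
      let ?y = "pinv (?r (0::nat)) \<circ>\<^sub>m x"
      have y: "?y \<in> partial_isometries n" "dom ?y = A" "ran ?y = B' 0"
        using transport(2)[OF n0 n0 n0, of x] x(1,2,4) unfolding x(3) by blast+
      have "order_preserving ?y" using y True by (auto simp: order_preserving_def)
      then show ?thesis using y n0 by blast
    next
      \<comment> \<open>Rotate so that the least element of \<open>A\<close> is sent to \<open>1\<close>.\<close>
      case False
      have "finite A" using A finite_subset by (auto simp: Omega_def)
      define a where "a = Min A"
      have a: "a \<in> A" "\<And>c. c \<in> A \<Longrightarrow> a \<le> c" using False \<open>finite A\<close> by (auto simp: a_def)
      then obtain b where b: "x a = Some b" using x(3) by blast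
      then have bO: "b \<in> Omega n" using x(1) by (auto simp: partial_isometries_iff)
      \<comment> \<open>The rotation by \<open>b - 1\<close> sends 1 to \<open>b\<close>, so its
        inverse brings the image of \<open>a\<close> to 1.\<close>
      define s where "s = b - 1"
      have s: "s < n" using bO by (auto simp: s_def Omega_def)
      let ?y = "pinv (?r s) \<circ>\<^sub>m x"
      have y: "?y \<in> partial_isometries n" "orientation_preserving ?y" "dom ?y = A" "ran ?y = B' s"
        using transport(2)[OF s s s, of x] x by auto
      have "?r s 1 = Some b" using s n bO by (auto simp: rotation_power_eq s_def Omega_def)
      then have "?y a = Some 1"
        using b pinv_isometry_Some_iff[OF rotation_power_props(1)[OF n s]]
        by (simp add: map_comp_Some_iff)
      moreover have "u \<le> v" if y': "?y a = Some 1" "?y c = Some u" "?y d = Some v" and "c \<le> d" for c d u v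
      proof -
        have pos: "1 \<le> u" "1 \<le> v" using y(1) y' by (auto simp: partial_isometries_iff Omega_def)
        have "a \<le> c" using a y(3) y' by blast
        then consider "c = d" | "c = a" | "a < c" "c < d" using \<open>c \<le> d\<close> by linarith
        then show ?thesis
        proof cases
          case 3
          then have "cyc a c d" by (simp add: cyc_def)
          \<comment> \<open>No image lies below 1, which leaves \<open>1 < u < v\<close> as the only
            way for this triple to be in cyclic order.\<close>
          then have "cyc 1 u v"
            using y(2)[unfolded orientation_preserving_iff[OF y(1)]] y' by blast
          then show ?thesis using pos unfolding cyc_def by linarith
        qed (use y' pos in auto)
      qed
      ultimately have "order_preserving ?y" unfolding order_preserving_iff by blast
      then show ?thesis using y s by blast
    qed
  qed
  show ?L if ?R
  proof -
    obtain s x where "s < n" "x \<in> partial_isometries n" "order_preserving x" "dom x = A" "ran x = B' s"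
      using \<open>?R\<close> by blast
    then show ?thesis using transport(1)[of s x] orientation_preservingI[of x n] by blast
  qed
qed

theorem theorem3p3:
  fixes n :: nat
  assumes "n \<ge> 3"
  shows
    "(\<forall>\<alpha> \<in> carrier (ODI n). \<forall>\<beta> \<in> carrier (ODI n).
        Green_J (ODI n) \<alpha> \<beta> \<longleftrightarrow>
          (card (dom \<alpha>) = card (dom \<beta>) \<and> card (dom \<beta>) \<le> 1) \<or>
          (card (dom \<alpha>) = card (dom \<beta>) \<and> card (dom \<beta>) \<ge> 2 \<and>
            dist_tuple n (dom \<alpha>) = dist_tuple n (dom \<beta>)))
     \<and>
     (\<forall>\<alpha> \<in> carrier (MDI n). \<forall>\<beta> \<in> carrier (MDI n).
        Green_J (MDI n) \<alpha> \<beta> \<longleftrightarrow>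
          (card (dom \<alpha>) = card (dom \<beta>) \<and> card (dom \<beta>) \<le> 1) \<or>
          (card (dom \<alpha>) = card (dom \<beta>) \<and> card (dom \<beta>) \<ge> 2 \<and>
            (dist_tuple n (dom \<alpha>) = dist_tuple n (dom \<beta>) \<or>
             dist_tuple n (dom \<alpha>) = dist_tuple n (dom (reflection n \<otimes>\<^bsub>MDI n\<^esub> \<beta>)))))
     \<and>
     (\<forall>\<alpha> \<in> carrier (OPDI n). \<forall>\<beta> \<in> carrier (OPDI n).
        Green_J (OPDI n) \<alpha> \<beta> \<longleftrightarrow>
          (card (dom \<alpha>) = card (dom \<beta>) \<and> card (dom \<beta>) \<le> 1) \<or>
          (card (dom \<alpha>) = card (dom \<beta>) \<and> card (dom \<beta>) \<ge> 2 \<and>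
            (\<exists>s::nat. 0 \<le> s \<and> s \<le> n - 1 \<and>
              dist_tuple n (dom \<alpha>) =
                dist_tuple n (dom ((rotation n [^]\<^bsub>OPDI n\<^esub> s) \<otimes>\<^bsub>OPDI n\<^esub> \<beta>)))))"
proof (intro conjI ballI)
  fix \<alpha> \<beta> assume "\<alpha> \<in> carrier (ODI n)" "\<beta> \<in> carrier (ODI n)"
  then have \<alpha>: "\<alpha> \<in> {\<alpha> \<in> partial_isometries n. order_preserving \<alpha>}"
    and \<beta>: "\<beta> \<in> {\<alpha> \<in> partial_isometries n. order_preserving \<alpha>}"
    by (simp_all add: ODI_def DI_def)
  have eq: "ODI n = odi.M n" by (simp add: ODI_def DI_def)
  show "Green_J (ODI n) \<alpha> \<beta> \<longleftrightarrow>
          (card (dom \<alpha>) = card (dom \<beta>) \<and> card (dom \<beta>) \<le> 1) \<or>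
          (card (dom \<alpha>) = card (dom \<beta>) \<and> card (dom \<beta>) \<ge> 2 \<and>
            dist_tuple n (dom \<alpha>) = dist_tuple n (dom \<beta>))"
    using order_isometry_iff[of "dom \<alpha>" n "dom \<beta>"] \<alpha> \<beta> dom_subset_Omega
    unfolding eq odi.Green_J_iff[OF \<alpha> \<beta>] by auto
next
  fix \<alpha> \<beta> assume "\<alpha> \<in> carrier (MDI n)" "\<beta> \<in> carrier (MDI n)"
  then have \<alpha>: "\<alpha> \<in> {\<alpha> \<in> partial_isometries n. order_preserving \<alpha> \<or> order_reversing \<alpha>}"
    and \<beta>: "\<beta> \<in> {\<alpha> \<in> partial_isometries n. order_preserving \<alpha> \<or> order_reversing \<alpha>}"
    by (simp_all add: MDI_def DI_def)
  have eq: "MDI n = mdi.M n" by (simp add: MDI_def DI_def)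
  have mult: "reflection n \<otimes>\<^bsub>mdi.M n\<^esub> \<beta> = \<beta> \<circ>\<^sub>m reflection n" by (simp add: DI_def)
  have sub: "dom \<alpha> \<subseteq> Omega n" "dom \<beta> \<subseteq> Omega n" "dom (\<beta> \<circ>\<^sub>m reflection n) \<subseteq> Omega n"
    using \<alpha> \<beta> dom_subset_Omega by (auto simp: map_comp_Some_iff reflection_Some_iff)
  \<comment> \<open>The reflection is a permutation, so the size condition for the preimage becomes
    a condition on \<open>dom \<beta>\<close>, common to both alternatives.\<close>
  have card: "card (dom (\<beta> \<circ>\<^sub>m reflection n)) = card (dom \<beta>)"
    using mdi.card_dom_comp_permutation[of "reflection n"] reflection_props sub by blast
  show "Green_J (MDI n) \<alpha> \<beta> \<longleftrightarrow>
          (card (dom \<alpha>) = card (dom \<beta>) \<and> card (dom \<beta>) \<le> 1) \<or>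
          (card (dom \<alpha>) = card (dom \<beta>) \<and> card (dom \<beta>) \<ge> 2 \<and>
            (dist_tuple n (dom \<alpha>) = dist_tuple n (dom \<beta>) \<or>
             dist_tuple n (dom \<alpha>) = dist_tuple n (dom (reflection n \<otimes>\<^bsub>MDI n\<^esub> \<beta>))))"
    unfolding eq mult mdi.Green_J_iff[OF \<alpha> \<beta>] monotone_isometry_iff[OF sub(2)]
      order_isometry_iff[OF sub(1,2)] order_isometry_iff[OF sub(1,3)] card
    by auto
next
  fix \<alpha> \<beta> assume "\<alpha> \<in> carrier (OPDI n)" "\<beta> \<in> carrier (OPDI n)"
  then have \<alpha>: "\<alpha> \<in> {\<alpha> \<in> partial_isometries n. orientation_preserving \<alpha>}"
    and \<beta>: "\<beta> \<in> {\<alpha> \<in> partial_isometries n. orientation_preserving \<alpha>}"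
    by (simp_all add: OPDI_def DI_def)
  have n: "n \<ge> 1" using assms by simp
  let ?r = "\<lambda>s::nat. rotation n [^]\<^bsub>OPDI n\<^esub> s"
  have eq: "OPDI n = opdi.M n" by (simp add: OPDI_def DI_def)
  have range: "s < n \<longleftrightarrow> 0 \<le> s \<and> s \<le> n - 1" for s using n by linarith
  have mult: "x \<otimes>\<^bsub>OPDI n\<^esub> \<beta> = \<beta> \<circ>\<^sub>m x" for x by (simp add: OPDI_def DI_def)
  have sub: "dom \<alpha> \<subseteq> Omega n" "dom \<beta> \<subseteq> Omega n"
    using \<alpha> \<beta> dom_subset_Omega by auto
  have order: "(\<exists>x \<in> partial_isometries n. order_preserving x \<and> dom x = dom \<alpha> \<and> ran x = dom (\<beta> \<circ>\<^sub>m ?r s)) \<longleftrightarrow>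
      card (dom \<alpha>) = card (dom \<beta>) \<and>
      (card (dom \<beta>) \<le> 1 \<or> dist_tuple n (dom \<alpha>) = dist_tuple n (dom (\<beta> \<circ>\<^sub>m ?r s)))"
    if s: "s < n" for s
  proof -
    note r = rotation_power_props[OF n s]
    have "dom (\<beta> \<circ>\<^sub>m ?r s) \<subseteq> dom (?r s)" by (auto simp: map_comp_Some_iff)
    then have "dom (\<beta> \<circ>\<^sub>m ?r s) \<subseteq> Omega n" using r(3) by simp
    moreover have "card (dom (\<beta> \<circ>\<^sub>m ?r s)) = card (dom \<beta>)"
      using opdi.card_dom_comp_permutation[of "?r s"] r sub by blast
    ultimately show ?thesis using order_isometry_iff[OF sub(1)] by simp
  qed
  have "Green_J (OPDI n) \<alpha> \<beta> \<longleftrightarrow> (\<exists>s<n. card (dom \<alpha>) = card (dom \<beta>) \<and>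
      (card (dom \<beta>) \<le> 1 \<or> dist_tuple n (dom \<alpha>) = dist_tuple n (dom (\<beta> \<circ>\<^sub>m ?r s))))"
    using opdi.Green_J_iff[OF \<alpha> \<beta>, folded eq] oriented_isometry_iff[OF n sub] order by auto
  \<comment> \<open>The size conditions do not mention \<open>s\<close>, so the quantifier moves
    past them; for at most one point, \<open>s = 0\<close> is a witness.\<close>
  also have "\<dots> \<longleftrightarrow> card (dom \<alpha>) = card (dom \<beta>) \<and> (card (dom \<beta>) \<le> 1 \<or>
      (\<exists>s<n. dist_tuple n (dom \<alpha>) = dist_tuple n (dom (\<beta> \<circ>\<^sub>m ?r s))))"
    using n by (auto intro: exI[of _ 0])
  also have "(\<exists>s<n. dist_tuple n (dom \<alpha>) = dist_tuple n (dom (\<beta> \<circ>\<^sub>m ?r s))) \<longleftrightarrow>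
      (\<exists>s::nat. 0 \<le> s \<and> s \<le> n - 1 \<and>
        dist_tuple n (dom \<alpha>) = dist_tuple n (dom (?r s \<otimes>\<^bsub>OPDI n\<^esub> \<beta>)))"
    unfolding mult range by (simp only: conj_assoc)
  finally show "Green_J (OPDI n) \<alpha> \<beta> \<longleftrightarrow>
          (card (dom \<alpha>) = card (dom \<beta>) \<and> card (dom \<beta>) \<le> 1) \<or>
          (card (dom \<alpha>) = card (dom \<beta>) \<and> card (dom \<beta>) \<ge> 2 \<and>
            (\<exists>s::nat. 0 \<le> s \<and> s \<le> n - 1 \<and>
              dist_tuple n (dom \<alpha>) =
                dist_tuple n (dom ((rotation n [^]\<^bsub>OPDI n\<^esub> s) \<otimes>\<^bsub>OPDI n\<^esub> \<beta>))))"
    by auto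
qed

end
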